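(* Let $F_0:[0,\infty)\to[0,\infty)$ be a Lipschitz function with $0\le F_0(x)\le x$ for all $x\ge0$, with $F_0$ sublinear and $0\le\partial_xF_0\le1$ a.e. on $[0,\infty)$. Assume that $$\lim_{x\to\infty}\frac{F_0(x)}{x^{2/3}}=0.$$ Let $F$ be the unique viscosity solution of $$\begin{cases}\partial_tF+\tfrac12(\partial_xF-1)(\partial_xF-2)+\dfrac Fx-1=0&\text{in }(0,\infty)^2,\\ 0\le F(x,t)\le x&\text{on }[0,\infty)^2,\\ F(x,0)=F_0(x)&\text{on }[0,\infty).\end{cases}$$ Then, as $t\to\infty$, $F(x,t)\to0$ locally uniformly for $x\in[0,\infty)$.
   Context: A function $g$ on $[0,\infty)$ is sublinear if $\lim_{x\to\infty}g(x)/x=0$. Solutions are continuous on $[0,\infty)^2$ and are understood in the viscosity sense, with $F=F(x,t)$, $x$ the space variable and $t$ the time variable. Under the stated assumptions on $F_0$ (namely $0\le F_0(x)\le x$, sublinearity, $0\le\partial_xF_0\le1$), the problem has a unique (sublinear in $x$) viscosity solution $F$, which is known to be globally Lipschitz and to satisfy $0\le\partial_xF\le1$ a.e. on $[0,\infty)^2$. Locally uniformly means uniformly on compact subsets of $[0,\infty)$. *)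

theory Defs
  imports "HOL-Analysis.Analysis"
begin

definition sublinear :: "(real \<Rightarrow> real) \<Rightarrow> bool" where
  "sublinear g \<longleftrightarrow> ((\<lambda>x. g x / x) \<longlongrightarrow> 0) at_top"

text \<open>Points of the quadrant are pairs \<open>(x, t)\<close>, space first and time second.\<close>

definition quadrant :: "(real \<times> real) set" where
  "quadrant = {0<..} \<times> {0<..}"

definition closed_quadrant :: "(real \<times> real) set" where
  "closed_quadrant = {0..} \<times> {0..}"

definition C1_with_partials ::
  "(real \<times> real) set \<Rightarrow> (real \<times> real \<Rightarrow> real) \<Rightarrow> (real \<times> real \<Rightarrow> real) \<Rightarrow> (real \<times> real \<Rightarrow> real) \<Rightarrow> bool"
where
  "C1_with_partials \<Omega> \<phi> \<phi>x \<phi>t \<longleftrightarrow>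
     (\<forall>z\<in>\<Omega>. (\<phi> has_derivative (\<lambda>(h, k). \<phi>x z * h + \<phi>t z * k)) (at z)) \<and>
     continuous_on \<Omega> \<phi>x \<and> continuous_on \<Omega> \<phi>t"

text \<open>
  Viscosity sub- and supersolutions of \<open>E(x, t, u, u\<^sub>x, u\<^sub>t) = 0\<close> in the open set \<open>\<Omega>\<close>.
  Test functions touch at local, not necessarily strict, extrema of \<open>u - \<phi>\<close>.
\<close>

definition viscosity_subsolution ::
  "(real \<times> real) set \<Rightarrow> (real \<Rightarrow> real \<Rightarrow> real \<Rightarrow> real \<Rightarrow> real \<Rightarrow> real) \<Rightarrow> (real \<times> real \<Rightarrow> real) \<Rightarrow> bool"
where
  "viscosity_subsolution \<Omega> E u \<longleftrightarrow>
     (\<forall>\<phi> \<phi>x \<phi>t x t. C1_with_partials \<Omega> \<phi> \<phi>x \<phi>t \<and> (x, t) \<in> \<Omega> \<and>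
        (\<forall>\<^sub>F z in nhds (x, t). u z - \<phi> z \<le> u (x, t) - \<phi> (x, t)) \<longrightarrow>
        E x t (u (x, t)) (\<phi>x (x, t)) (\<phi>t (x, t)) \<le> 0)"

definition viscosity_supersolution ::
  "(real \<times> real) set \<Rightarrow> (real \<Rightarrow> real \<Rightarrow> real \<Rightarrow> real \<Rightarrow> real \<Rightarrow> real) \<Rightarrow> (real \<times> real \<Rightarrow> real) \<Rightarrow> bool"
where
  "viscosity_supersolution \<Omega> E u \<longleftrightarrow>
     (\<forall>\<phi> \<phi>x \<phi>t x t. C1_with_partials \<Omega> \<phi> \<phi>x \<phi>t \<and> (x, t) \<in> \<Omega> \<and>
        (\<forall>\<^sub>F z in nhds (x, t). u z - \<phi> z \<ge> u (x, t) - \<phi> (x, t)) \<longrightarrow>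
        E x t (u (x, t)) (\<phi>x (x, t)) (\<phi>t (x, t)) \<ge> 0)"

definition viscosity_solution ::
  "(real \<times> real) set \<Rightarrow> (real \<Rightarrow> real \<Rightarrow> real \<Rightarrow> real \<Rightarrow> real \<Rightarrow> real) \<Rightarrow> (real \<times> real \<Rightarrow> real) \<Rightarrow> bool"
where
  "viscosity_solution \<Omega> E u \<longleftrightarrow> viscosity_subsolution \<Omega> E u \<and> viscosity_supersolution \<Omega> E u"

definition coag_frag_eq :: "real \<Rightarrow> real \<Rightarrow> real \<Rightarrow> real \<Rightarrow> real \<Rightarrow> real" where
  "coag_frag_eq x t r p q = q + 1/2 * (p - 1) * (p - 2) + r / x - 1"

text \<open>
  Solutions are taken in the class of functions sublinear in \<open>x\<close>, the class in which the
  problem is uniquely solvable.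
\<close>

definition coag_frag_solution :: "(real \<Rightarrow> real) \<Rightarrow> (real \<times> real \<Rightarrow> real) \<Rightarrow> bool" where
  "coag_frag_solution F0 F \<longleftrightarrow>
     continuous_on closed_quadrant F \<and>
     viscosity_solution quadrant coag_frag_eq F \<and>
     (\<forall>x\<ge>0. \<forall>t\<ge>0. 0 \<le> F (x, t) \<and> F (x, t) \<le> x) \<and>
     (\<forall>x\<ge>0. F (x, 0) = F0 x) \<and>
     (\<forall>t\<ge>0. sublinear (\<lambda>x. F (x, t)))"

end

theory Submission
  imports Defs
begin

text \<open>
  The equation reads \<open>F\<^sub>t + p\<^sup>2/2 - 3p/2 + F/x = 0\<close> with \<open>p = F\<^sub>x\<close>. Since \<open>p\<^sup>2/2\<close> is nonnegative,
  a subsolution of it is also a subsolution of the \<^emph>\<open>linear\<close> equation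
  \<open>F\<^sub>t - 3/2 F\<^sub>x + F/x = 0\<close>. The weight \<open>x\<^sup>-\<^sup>2\<^sup>/\<^sup>3\<close> absorbs the zeroth-order term: for
  \<open>w = F / x\<^sup>2\<^sup>/\<^sup>3\<close> it becomes the pure transport inequality \<open>w\<^sub>t - 3/2 w\<^sub>x \<le> 0\<close>
  (\<open>weighted_subsolution_transport\<close>), and such a \<open>w\<close> does not increase in time along the lines on which
  \<open>x + 3t/2\<close> is constant (\<open>transport_subsolution_nonincreasing\<close>). Following such a line back to time
  \<open>0\<close> gives \<open>F(x,t) \<le> x\<^sup>2\<^sup>/\<^sup>3 F\<^sub>0(y) / y\<^sup>2\<^sup>/\<^sup>3\<close> with \<open>y = x + 3t/2\<close>
  (\<open>subsolution_le_characteristic\<close>). As \<open>t\<close> grows, \<open>y\<close> tends to infinity uniformly in \<open>x\<close>, so the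
  hypothesis \<open>F\<^sub>0(y) = o(y\<^sup>2\<^sup>/\<^sup>3)\<close> makes the right-hand side vanish uniformly for bounded \<open>x\<close>.

  In terms of optimal control, the running cost of the equation vanishes for velocity \<open>-3/2\<close>, and the
  bound is the cost of the trajectory with this velocity.
\<close>

lemma open_quadrant: "open quadrant"
  unfolding quadrant_def by (intro open_Times) auto

text \<open>
  If \<open>\<theta>\<close> touches \<open>u / x\<^sup>2\<^sup>/\<^sup>3\<close> from above up to the constant \<open>c\<close>, then \<open>x\<^sup>2\<^sup>/\<^sup>3 (\<theta> + c)\<close> touches \<open>u\<close>
  from above. In the equation for this test function, the derivative of the weight cancels
  \<open>u/x\<close>, and the square of the slope only helps.
\<close>

lemma weighted_subsolution_transport:
  fixes u \<theta> \<theta>x \<theta>t :: "real \<times> real \<Rightarrow> real"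
  assumes sub: "viscosity_subsolution quadrant coag_frag_eq u"
    and C1: "C1_with_partials quadrant \<theta> \<theta>x \<theta>t"
    and z: "(x, t) \<in> quadrant"
    and touch: "\<forall>\<^sub>F z in nhds (x, t).
      u z / fst z powr (2/3) - \<theta> z \<le> u (x, t) / x powr (2/3) - \<theta> (x, t)"
  shows "\<theta>t (x, t) \<le> 3/2 * \<theta>x (x, t)"
proof -
  define c where "c = u (x, t) / x powr (2/3) - \<theta> (x, t)"
  define \<phi> where "\<phi> z = fst z powr (2/3) * (\<theta> z + c)" for z :: "real \<times> real"
  define \<phi>x where "\<phi>x z = 2/3 * fst z powr (-1/3) * (\<theta> z + c) + fst z powr (2/3) * \<theta>x z"
    for z :: "real \<times> real"
  define \<phi>t where "\<phi>t z = fst z powr (2/3) * \<theta>t z" for z :: "real \<times> real"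
  have x: "x > 0" using z by (auto simp: quadrant_def)
  have d\<theta>: "(\<theta> has_derivative (\<lambda>(h, k). \<theta>x z * h + \<theta>t z * k)) (at z)" if "z \<in> quadrant" for z
    using C1 that unfolding C1_with_partials_def by blast
  have cont\<theta>: "continuous_on quadrant \<theta>"
    by (meson d\<theta> continuous_at_imp_continuous_on has_derivative_continuous)
  have contp: "continuous_on quadrant (\<lambda>z. fst z powr a)" for a :: real
    by (intro continuous_intros) (auto simp: quadrant_def)
  have "C1_with_partials quadrant \<phi> \<phi>x \<phi>t"
    unfolding C1_with_partials_def
  proof (intro conjI ballI)
    fix z :: "real \<times> real" assume zq: "z \<in> quadrant"
    then have pos: "fst z > 0" by (auto simp: quadrant_def)
    have dpow: "((\<lambda>z::real \<times> real. fst z powr (2/3)) has_derivative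
        (\<lambda>h. 2/3 * fst z powr (-1/3) * fst h)) (at z)"
    proof -
      have dpowr: "((\<lambda>s. s powr (2/3)) has_real_derivative 2/3 * fst z powr (2/3 - 1)) (at (fst z))"
        using has_real_derivative_powr[OF pos, of "2/3"] .
      have exponent: "2/3 - 1 = (-1/3 :: real)" by simp
      have "((\<lambda>s. s powr (2/3)) has_derivative (\<lambda>s. 2/3 * fst z powr (-1/3) * s)) (at (fst z))"
        using dpowr unfolding has_field_derivative_def exponent .
      from has_derivative_compose[OF has_derivative_fst[OF has_derivative_ident] this]
      show ?thesis by simp
    qed
    have "(\<phi> has_derivative (\<lambda>h. fst z powr (2/3) * ((\<lambda>(h, k). \<theta>x z * h + \<theta>t z * k) h + 0)
        + 2/3 * fst z powr (-1/3) * fst h * (\<theta> z + c))) (at z)"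
      unfolding \<phi>_def
      by (intro has_derivative_mult dpow has_derivative_add d\<theta> zq has_derivative_const)
    moreover have "(\<lambda>h. fst z powr (2/3) * ((\<lambda>(h, k). \<theta>x z * h + \<theta>t z * k) h + 0)
        + 2/3 * fst z powr (-1/3) * fst h * (\<theta> z + c)) = (\<lambda>(h, k). \<phi>x z * h + \<phi>t z * k)"
      by (auto simp: fun_eq_iff \<phi>x_def \<phi>t_def algebra_simps)
    ultimately show "(\<phi> has_derivative (\<lambda>(h, k). \<phi>x z * h + \<phi>t z * k)) (at z)"
      by simp
  next
    show "continuous_on quadrant \<phi>x" "continuous_on quadrant \<phi>t"
      using C1 unfolding \<phi>x_def \<phi>t_def C1_with_partials_def
      by (auto intro!: continuous_intros contp cont\<theta>)
  qed
  moreover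
  have at_z: "\<phi> (x, t) = u (x, t)"
    using x by (simp add: \<phi>_def c_def)
  have "\<forall>\<^sub>F z in nhds (x, t). z \<in> quadrant"
    using open_quadrant z by (rule eventually_nhds_in_open)
  with touch have "\<forall>\<^sub>F z in nhds (x, t). u z - \<phi> z \<le> u (x, t) - \<phi> (x, t)"
  proof eventually_elim
    case (elim z)
    then have "fst z > 0" by (auto simp: quadrant_def)
    moreover have "u z / fst z powr (2/3) \<le> \<theta> z + c"
      using elim by (simp add: c_def)
    ultimately have "u z \<le> \<phi> z"
      by (simp add: \<phi>_def field_simps)
    then show ?case using at_z by simp
  qed
  ultimately have "coag_frag_eq x t (u (x, t)) (\<phi>x (x, t)) (\<phi>t (x, t)) \<le> 0"
    using sub z unfolding viscosity_subsolution_def by blast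
  then have "1/2 * (\<phi>x (x, t))\<^sup>2 + \<phi>t (x, t) - 3/2 * \<phi>x (x, t) + u (x, t) / x \<le> 0"
    unfolding coag_frag_eq_def by (simp add: power2_eq_square field_simps)
  moreover have "x powr (2/3) / x = x powr (-1/3)"
    using x powr_diff[of x "2/3" 1] by simp
  then have "u (x, t) / x = x powr (-1/3) * (\<theta> (x, t) + c)"
    unfolding at_z[symmetric] \<phi>_def by (metis fst_conv times_divide_eq_left)
  then have "\<phi>t (x, t) - 3/2 * \<phi>x (x, t) + u (x, t) / x
      = x powr (2/3) * (\<theta>t (x, t) - 3/2 * \<theta>x (x, t))"
    by (simp add: \<phi>x_def \<phi>t_def algebra_simps)
  ultimately have "1/2 * (\<phi>x (x, t))\<^sup>2 + x powr (2/3) * (\<theta>t (x, t) - 3/2 * \<theta>x (x, t)) \<le> 0"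
    by linarith
  then have "x powr (2/3) * (\<theta>t (x, t) - 3/2 * \<theta>x (x, t)) \<le> 0"
    using zero_le_power2[of "\<phi>x (x, t)"] by linarith
  then show ?thesis
    using x by (simp add: mult_le_0_iff)
qed

text \<open>
  If \<open>w\<close> were larger at the later point \<open>(x, s\<^sub>1)\<close> of a characteristic than at the earlier one, then
  \<open>w\<close> minus an exponential in time, which is small at \<open>s\<^sub>1\<close> and huge at a slightly later time \<open>s\<^sub>2\<close>,
  has an interior maximum between the two times along that line. A steep quadratic penalty in the
  transverse variable \<open>x + 3t/2\<close>, which transport does not see, turns it into an interior maximum
  in a parallelogram around the line. There the test function strictly increases along the
  characteristic, contradicting the transport inequality.
\<close>

lemma transport_subsolution_nonincreasing:
  fixes w :: "real \<times> real \<Rightarrow> real"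
  assumes cont: "continuous_on quadrant w"
    and transport: "\<And>\<theta> \<theta>x \<theta>t x t. C1_with_partials quadrant \<theta> \<theta>x \<theta>t \<Longrightarrow> (x, t) \<in> quadrant \<Longrightarrow>
        (\<forall>\<^sub>F z in nhds (x, t). w z - \<theta> z \<le> w (x, t) - \<theta> (x, t)) \<Longrightarrow>
        \<theta>t (x, t) \<le> 3/2 * \<theta>x (x, t)"
    and x: "0 < x" and s0: "0 < s0" and s01: "s0 < s1"
  shows "w (x, s1) \<le> w (x + 3/2 * (s1 - s0), s0)"
proof (rule ccontr)
  define y where "y = x + 3/2 * s1"
  define g where "g \<sigma> s = w (\<sigma> - 3/2 * s, s)" for \<sigma> s
  assume "\<not> ?thesis"
  then have less: "g y s0 < g y s1"
    by (simp add: g_def y_def right_diff_distrib add_diff_eq)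
  \<comment> \<open>The exponential is worth \<open>A\<close> at \<open>s1\<close>: half of the assumed gain, so that the comparison with
    \<open>s0\<close> survives. The rate \<open>k\<close> is what makes it exceed \<open>g y s2 - g y s1 + A\<close> at \<open>s2\<close>.\<close>
  define A where "A = (g y s1 - g y s0) / 2"
  have A: "A > 0" using less by (simp add: A_def)
  \<comment> \<open>At time \<open>s2\<close> the characteristic has only moved from \<open>x\<close> to \<open>x/2\<close>, so it is still inside.\<close>
  define s2 where "s2 = s1 + x / 3"
  have s12: "s1 < s2" using x by (simp add: s2_def)
  define k where "k = (\<bar>g y s1\<bar> + \<bar>g y s2\<bar> + 1) / (A * (s2 - s1))"
  have k: "k > 0" using A s12 by (simp add: k_def add_nonneg_pos)
  define \<psi> where "\<psi> s = A * exp (k * (s - s1))" for s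
  have \<psi>pos: "\<psi> s > 0" for s using A by (simp add: \<psi>_def)
  define m where "m = g y s1 - \<psi> s1"
  have low0: "g y s0 - \<psi> s0 < m"
  proof -
    have "\<psi> s1 = A" by (simp add: \<psi>_def)
    then have "m - g y s0 = A" by (simp add: m_def A_def field_simps)
    then show ?thesis using A \<psi>pos[of s0] by linarith
  qed
  have low2: "g y s2 - \<psi> s2 < m"
  proof -
    have "A * (1 + k * (s2 - s1)) \<le> \<psi> s2"
      unfolding \<psi>_def using A by (intro mult_left_mono exp_ge_add_one_self) auto
    moreover have "A * (1 + k * (s2 - s1)) = A + \<bar>g y s1\<bar> + \<bar>g y s2\<bar> + 1"
      using A s12 by (simp add: k_def field_simps)
    moreover have "\<psi> s1 = A" by (simp add: \<psi>_def)
    ultimately show ?thesis unfolding m_def by linarith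
  qed
  have inside: "(\<sigma> - 3/2 * s, s) \<in> quadrant" if "\<bar>\<sigma> - y\<bar> \<le> x / 4" "s0 \<le> s" "s \<le> s2" for \<sigma> s
  proof -
    have "\<sigma> - 3/2 * s > 0"
      using abs_ge_minus_self[of "\<sigma> - y"] that x unfolding y_def s2_def by linarith
    then show ?thesis using that s0 by (simp add: quadrant_def)
  qed
  have near: "\<forall>\<^sub>F \<sigma> in nhds y. g \<sigma> s - \<psi> s < m" if "g y s - \<psi> s < m" "s0 \<le> s" "s \<le> s2" for s
  proof -
    have "isCont w (y - 3/2 * s, s)"
      using cont inside[of y s] that x open_quadrant by (simp add: continuous_on_eq_continuous_at)
    then have "isCont (\<lambda>\<sigma>. w (\<sigma> - 3/2 * s, s)) y"
      using isCont_o2[where f = "\<lambda>\<sigma>. (\<sigma> - 3/2 * s, s)" and a = y and g = w]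
      by (simp add: continuous_intros)
    then have "isCont (\<lambda>\<sigma>. g \<sigma> s - \<psi> s) y"
      unfolding g_def by (intro continuous_intros)
    then have "((\<lambda>\<sigma>. g \<sigma> s - \<psi> s) \<longlongrightarrow> g y s - \<psi> s) (nhds y)"
      by (simp add: continuous_at tendsto_nhds_iff)
    then show ?thesis using that(1) by (rule order_tendstoD)
  qed
  have "\<forall>\<^sub>F \<sigma> in nhds y. g \<sigma> s0 - \<psi> s0 < m \<and> g \<sigma> s2 - \<psi> s2 < m"
    using near[of s0] near[of s2] low0 low2 s01 s12 by (intro eventually_conj) auto
  then obtain d where d: "d > 0"
    and dm: "\<And>\<sigma>. dist \<sigma> y < d \<Longrightarrow> g \<sigma> s0 - \<psi> s0 < m \<and> g \<sigma> s2 - \<psi> s2 < m"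
    unfolding eventually_nhds_metric by blast
  define r where "r = min (d / 2) (x / 4)"
  have r: "r > 0" "r \<le> x / 4" "r < d" using d x by (auto simp: r_def min_def)
  have ends: "g \<sigma> s0 - \<psi> s0 < m" "g \<sigma> s2 - \<psi> s2 < m" if "\<bar>\<sigma> - y\<bar> \<le> r" for \<sigma>
    using dm[of \<sigma>] that r by (auto simp: dist_real_def)
  define B where "B = {y - r..y + r} \<times> {s0..s2}"
  have B: "compact B" "(y, s1) \<in> B"
    using r s01 s12 unfolding B_def by (auto intro: compact_Times)
  have contg: "continuous_on B (\<lambda>(\<sigma>, s). g \<sigma> s)"
    unfolding g_def case_prod_unfold
  proof (intro continuous_on_compose2[OF cont] continuous_intros)
    show "(\<lambda>p. (fst p - 3/2 * snd p, snd p)) ` B \<subseteq> quadrant"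
    proof clarify
      fix \<sigma> s assume "(\<sigma>, s) \<in> B"
      then have "\<bar>\<sigma> - y\<bar> \<le> r" "s0 \<le> s" "s \<le> s2"
        by (simp_all add: B_def abs_le_iff)
      then show "(fst (\<sigma>, s) - 3/2 * snd (\<sigma>, s), snd (\<sigma>, s)) \<in> quadrant"
        using inside[of \<sigma> s] r(2) by simp
    qed
  qed
  obtain M where M: "\<And>\<sigma> s. (\<sigma>, s) \<in> B \<Longrightarrow> g \<sigma> s \<le> M"
    using continuous_attains_sup[OF B(1) _ contg] B(2) by fastforce
  \<comment> \<open>Large enough for the penalty to rule out a maximum on the sides \<open>\<bar>\<sigma> - y\<bar> = r\<close>.\<close>
  define n where "n = (\<bar>M\<bar> + \<bar>m\<bar> + 1) / r\<^sup>2"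
  have n: "n * r\<^sup>2 = \<bar>M\<bar> + \<bar>m\<bar> + 1" "n \<ge> 0" using r by (auto simp: n_def)
  define \<Phi> where "\<Phi> \<sigma> s = g \<sigma> s - \<psi> s - n * (\<sigma> - y)\<^sup>2" for \<sigma> s
  have "continuous_on B (\<lambda>(\<sigma>, s). \<Phi> \<sigma> s)"
    using contg unfolding \<Phi>_def \<psi>_def case_prod_unfold by (intro continuous_intros)
  then obtain \<sigma>' s' where max_in: "(\<sigma>', s') \<in> B"
    and max: "\<And>\<sigma> s. (\<sigma>, s) \<in> B \<Longrightarrow> \<Phi> \<sigma> s \<le> \<Phi> \<sigma>' s'"
    using continuous_attains_sup[OF B(1), of "\<lambda>(\<sigma>, s). \<Phi> \<sigma> s"] B(2) by fastforce
  have "m \<le> \<Phi> \<sigma>' s'"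
    using max[OF B(2)] by (simp add: \<Phi>_def m_def)
  moreover have "0 \<le> n * (\<sigma>' - y)\<^sup>2" using n by simp
  ultimately have ge: "m \<le> g \<sigma>' s' - \<psi> s'" "m + n * (\<sigma>' - y)\<^sup>2 \<le> g \<sigma>' s' - \<psi> s'"
    unfolding \<Phi>_def by linarith+
  have in': "\<bar>\<sigma>' - y\<bar> \<le> r" "s0 \<le> s'" "s' \<le> s2" using max_in by (auto simp: B_def)
  have "s' \<noteq> s0" "s' \<noteq> s2" using ends[OF in'(1)] ge(1) by auto
  moreover have "\<bar>\<sigma>' - y\<bar> \<noteq> r"
  proof
    assume "\<bar>\<sigma>' - y\<bar> = r"
    then have "(\<sigma>' - y)\<^sup>2 = r\<^sup>2" by (metis power2_abs)
    then show False using ge(2) n(1) M[OF max_in] \<psi>pos[of s'] by simp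
  qed
  ultimately have strict: "\<bar>\<sigma>' - y\<bar> < r" "s0 < s'" "s' < s2" using in' by auto
  define x' where "x' = \<sigma>' - 3/2 * s'"
  define \<theta> where "\<theta> z = \<psi> (snd z) + n * (fst z + 3/2 * snd z - y)\<^sup>2" for z :: "real \<times> real"
  define \<theta>x where "\<theta>x z = 2 * n * (fst z + 3/2 * snd z - y)" for z :: "real \<times> real"
  define \<theta>t where "\<theta>t z = k * \<psi> (snd z) + 3 * n * (fst z + 3/2 * snd z - y)" for z :: "real \<times> real"
  have "C1_with_partials quadrant \<theta> \<theta>x \<theta>t"
    unfolding C1_with_partials_def
  proof (intro conjI ballI)
    fix z :: "real \<times> real"
    show "(\<theta> has_derivative (\<lambda>(h, k). \<theta>x z * h + \<theta>t z * k)) (at z)"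
      unfolding \<theta>_def \<theta>x_def \<theta>t_def \<psi>_def
      by (auto intro!: derivative_eq_intros simp: fun_eq_iff algebra_simps)
  qed (auto simp: \<theta>x_def \<theta>t_def \<psi>_def intro!: continuous_intros)
  moreover have "(x', s') \<in> quadrant"
    unfolding x'_def using inside[of \<sigma>' s'] strict r by simp
  moreover have "\<forall>\<^sub>F z in nhds (x', s'). w z - \<theta> z \<le> w (x', s') - \<theta> (x', s')"
  proof -
    define U where "U = {z::real \<times> real. \<bar>fst z + 3/2 * snd z - y\<bar> < r \<and> s0 < snd z \<and> snd z < s2}"
    have "open U"
      unfolding U_def by (intro open_Collect_conj open_Collect_less continuous_intros)
    moreover have "(x', s') \<in> U" using strict by (simp add: U_def x'_def)
    ultimately have "\<forall>\<^sub>F z in nhds (x', s'). z \<in> U" by (rule eventually_nhds_in_open)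
    then show ?thesis
    proof eventually_elim
      case (elim z)
      then have "(fst z + 3/2 * snd z, snd z) \<in> B"
        by (auto simp: U_def B_def abs_less_iff)
      from max[OF this] show ?case
        by (simp add: \<Phi>_def g_def \<theta>_def x'_def)
    qed
  qed
  ultimately have "\<theta>t (x', s') \<le> 3/2 * \<theta>x (x', s')"
    by (rule transport)
  then have "k * \<psi> s' \<le> 0" by (simp add: \<theta>t_def \<theta>x_def)
  then show False using k \<psi>pos[of s'] by (simp add: mult_le_0_iff)
qed

lemma subsolution_le_characteristic:
  fixes u :: "real \<times> real \<Rightarrow> real"
  assumes cont: "continuous_on closed_quadrant u"
    and sub: "viscosity_subsolution quadrant coag_frag_eq u"
    and x: "0 < x" and t: "0 < t"
  shows "u (x, t) / x powr (2/3) \<le> u (x + 3/2 * t, 0) / (x + 3/2 * t) powr (2/3)"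
proof -
  define w where "w z = u z / fst z powr (2/3)" for z
  have "quadrant \<subseteq> closed_quadrant" by (auto simp: quadrant_def closed_quadrant_def)
  then have contw: "continuous_on quadrant w"
    unfolding w_def using cont
    by (intro continuous_intros continuous_on_subset[OF cont]) (auto simp: quadrant_def)
  have transport: "\<theta>t (x, t) \<le> 3/2 * \<theta>x (x, t)"
    if "C1_with_partials quadrant \<theta> \<theta>x \<theta>t" "(x, t) \<in> quadrant"
      "\<forall>\<^sub>F z in nhds (x, t). w z - \<theta> z \<le> w (x, t) - \<theta> (x, t)" for \<theta> \<theta>x \<theta>t x t
    using weighted_subsolution_transport[OF sub that(1,2)] that(3) by (simp add: w_def)
  have le: "w (x, t) \<le> w (x + 3/2 * (t - s), s)" if "0 < s" "s < t" for s
    using contw transport x that by (rule transport_subsolution_nonincreasing)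
  have pos: "0 < x + 3/2 * (t - s)" if "s \<le> t" for s
    using that x by (auto intro: add_pos_nonneg)
  \<comment> \<open>The inequality at positive times \<open>s\<close> extends to \<open>s = 0\<close> by continuity up to the boundary.\<close>
  have "continuous_on {0..t} (\<lambda>s. w (x + 3/2 * (t - s), s))"
    unfolding w_def fst_conv
    by (intro continuous_intros continuous_on_compose2[OF cont])
      (use pos in \<open>auto simp: closed_quadrant_def less_imp_le less_imp_neq[symmetric]\<close>)
  then have "((\<lambda>s. w (x + 3/2 * (t - s), s)) \<longlongrightarrow> w (x + 3/2 * t, 0)) (at_right 0)"
    using t by (force dest: continuous_on_Icc_at_rightD)
  moreover have "\<forall>\<^sub>F s in at_right 0. w (x, t) \<le> w (x + 3/2 * (t - s), s)"
    using eventually_at_right_less[of "0::real"] order_tendstoD(2)[OF tendsto_ident_at t]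
    by eventually_elim (rule le)
  ultimately have "w (x, t) \<le> w (x + 3/2 * t, 0)"
    by (intro tendsto_lowerbound[of _ _ "at_right 0"]) auto
  then show ?thesis by (simp add: w_def)
qed

theorem theorem1p3:
  fixes F0 :: "real \<Rightarrow> real" and F :: "real \<times> real \<Rightarrow> real"
  assumes "\<exists>L. L-lipschitz_on {0..} F0"
    and "\<And>x. x \<ge> 0 \<Longrightarrow> 0 \<le> F0 x \<and> F0 x \<le> x"
    and "sublinear F0"
    and "AE x in lebesgue. x > 0 \<longrightarrow> (\<exists>D. (F0 has_real_derivative D) (at x) \<and> 0 \<le> D \<and> D \<le> 1)"
    and "((\<lambda>x. F0 x / x powr (2/3)) \<longlongrightarrow> 0) at_top"
    and "coag_frag_solution F0 F"
  shows "\<forall>K. compact K \<and> K \<subseteq> {0..} \<longrightarrow> uniform_limit K (\<lambda>t x. F (x, t)) (\<lambda>x. 0) at_top"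
proof (intro allI impI)
  fix K :: "real set" assume K: "compact K \<and> K \<subseteq> {0..}"
  have cont: "continuous_on closed_quadrant F"
    and sub: "viscosity_subsolution quadrant coag_frag_eq F"
    and bounds: "\<And>x t. x \<ge> 0 \<Longrightarrow> t \<ge> 0 \<Longrightarrow> 0 \<le> F (x, t) \<and> F (x, t) \<le> x"
    and init: "\<And>x. x \<ge> 0 \<Longrightarrow> F (x, 0) = F0 x"
    using assms(6) unfolding coag_frag_solution_def viscosity_solution_def by auto
  obtain R where R: "R > 0" "\<And>x. x \<in> K \<Longrightarrow> \<bar>x\<bar> \<le> R"
    using compact_imp_bounded[of K] K unfolding bounded_pos real_norm_def by blast
  show "uniform_limit K (\<lambda>t x. F (x, t)) (\<lambda>x. 0) at_top"
  proof (rule uniform_limitI)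
    fix e :: real assume e: "e > 0"
    define e' where "e' = e / R powr (2/3)"
    have e': "e' > 0" using e R by (simp add: e'_def)
    obtain Y where Y: "\<And>y. y \<ge> Y \<Longrightarrow> F0 y / y powr (2/3) < e'"
      using order_tendstoD(2)[OF assms(5) e'] unfolding eventually_at_top_linorder by blast
    show "\<forall>\<^sub>F t in at_top. \<forall>x\<in>K. dist (F (x, t)) 0 < e"
      using eventually_gt_at_top[of 0] eventually_ge_at_top[of Y]
    proof eventually_elim
      case (elim t)
      show ?case
      proof
        fix x assume xK: "x \<in> K"
        then have x0: "x \<ge> 0" using K by auto
        have xR: "x \<le> R" using R(2)[OF xK] by simp
        show "dist (F (x, t)) 0 < e"
        proof (cases "x = 0")
          case True
          then show ?thesis using bounds[of 0 t] elim e by simp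
        next
          case False
          then have x: "x > 0" using x0 by simp
          have "F (x, t) / x powr (2/3) \<le> F0 (x + 3/2 * t) / (x + 3/2 * t) powr (2/3)"
            using subsolution_le_characteristic[OF cont sub x elim(1)] init[of "x + 3/2 * t"] x elim
            by simp
          also have "\<dots> < e'" using x elim by (intro Y) simp
          finally have "F (x, t) < e' * x powr (2/3)"
            using x by (simp add: pos_divide_less_eq)
          also have "\<dots> \<le> e' * R powr (2/3)"
            using e' x xR by (intro mult_left_mono powr_mono2) auto
          also have "\<dots> = e" using R by (simp add: e'_def)
          finally show ?thesis using bounds[of x t] x elim by simp
        qed
      qed
    qed
  qed
qed

end
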